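(* Let $\mathcal C$ be a semiordered commutative (Abelian) real algebra with cone $\mathcal C_+$ and unit $I$. Suppose that $I\in\mathcal C_+$, that every element $a\in\mathcal C$ is bounded (i.e. there is a number $t>0$ with $-tI\le a\le tI$), and that the intersection of $\mathcal C_+$ with any affine straight line in $\mathcal C$ is closed (in the usual topology of the line). Then $\mathcal C$ is a phase algebra, i.e. there exists a Hausdorff compact set $X$ such that $\mathcal C$ is isomorphic, as an algebra and including the order, to a subalgebra of $C(X)$ that is dense in the supremum norm.
   Context: All algebras are real and associative. A cone in a real vector space $L$ is a convex subset $K\subset L$ such that $tv\in K$ whenever $v\in K$, $t\ge 0$, and such that $v\in K$, $-v\in K$ imply $v=0$. A cone defines the partial order $u\le v\iff v-u\in K$. A semiordered algebra is an algebra $\mathcal C$ with a fixed cone $\mathcal C_+\subset\mathcal C$ such that the product of any two elements of $\mathcal C_+$ lies in $\mathcal C_+$. $C(X)$ is the algebra of real-valued continuous functions on $X$ with the supremum norm, ordered by the cone of nonnegative functions; subalgebras carry the induced order. "Isomorphic including the order" means that there is an algebra isomorphism under which positive elements correspond exactly to positive elements. *)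

theory Defs
  imports "HOL-Analysis.Analysis"
begin

definition ordering_cone :: "'a::real_vector set \<Rightarrow> bool" where
  "ordering_cone K \<longleftrightarrow> convex K \<and> cone K \<and> (\<forall>v. v \<in> K \<and> - v \<in> K \<longrightarrow> v = 0)"

definition cone_le :: "'a::real_vector set \<Rightarrow> 'a \<Rightarrow> 'a \<Rightarrow> bool" where
  "cone_le K u v \<longleftrightarrow> v - u \<in> K"

text \<open>
  The algebra is the whole carrier type; its unit is passed explicitly where it is needed,
  because the class \<^class>\<open>real_algebra_1\<close> would exclude the zero algebra.
\<close>
definition semiordered_algebra :: "'a::real_algebra set \<Rightarrow> bool" where
  "semiordered_algebra K \<longleftrightarrow> ordering_cone K \<and> (\<forall>a\<in>K. \<forall>b\<in>K. a * b \<in> K)"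

definition is_unit_elt :: "'a::real_algebra \<Rightarrow> bool" where
  "is_unit_elt e \<longleftrightarrow> (\<forall>a. e * a = a \<and> a * e = a)"

definition bounded_elt :: "'a::real_algebra set \<Rightarrow> 'a \<Rightarrow> 'a \<Rightarrow> bool" where
  "bounded_elt K e a \<longleftrightarrow> (\<exists>t>0. cone_le K (- (t *\<^sub>R e)) a \<and> cone_le K a (t *\<^sub>R e))"

text \<open>
  For \<open>d \<noteq> 0\<close> the map \<open>t \<mapsto> p + t d\<close> is an affine parametrization of a straight line, and the
  usual topology of the line is the one transported from the reals.
\<close>
definition closed_on_lines :: "'a::real_vector set \<Rightarrow> bool" where
  "closed_on_lines K \<longleftrightarrow> (\<forall>p d. d \<noteq> 0 \<longrightarrow> closed {t::real. p + t *\<^sub>R d \<in> K})"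

text \<open>
  \<open>C(X)\<close> for a topology \<open>X\<close>, as a metric space under the supremum distance. Its elements are
  extensional functions (\<^const>\<open>undefined\<close> off \<^term>\<open>topspace X\<close>), so the pointwise operations have
  to be restricted. The boundedness condition in \<^const>\<open>cfunspace\<close> is automatic for compact \<open>X\<close>.
\<close>
abbreviation C_space :: "'x topology \<Rightarrow> ('x \<Rightarrow> real) metric" where
  "C_space X \<equiv> cfunspace X euclidean_metric"

definition C_plus :: "'x topology \<Rightarrow> ('x \<Rightarrow> real) \<Rightarrow> ('x \<Rightarrow> real) \<Rightarrow> 'x \<Rightarrow> real" where
  "C_plus X f g = (\<lambda>x\<in>topspace X. f x + g x)"

definition C_times :: "'x topology \<Rightarrow> ('x \<Rightarrow> real) \<Rightarrow> ('x \<Rightarrow> real) \<Rightarrow> 'x \<Rightarrow> real" where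
  "C_times X f g = (\<lambda>x\<in>topspace X. f x * g x)"

definition C_scale :: "'x topology \<Rightarrow> real \<Rightarrow> ('x \<Rightarrow> real) \<Rightarrow> 'x \<Rightarrow> real" where
  "C_scale X c f = (\<lambda>x\<in>topspace X. c * f x)"

definition C_nonneg :: "'x topology \<Rightarrow> ('x \<Rightarrow> real) set" where
  "C_nonneg X = {f \<in> mspace (C_space X). \<forall>x\<in>topspace X. 0 \<le> f x}"

definition C_subalgebra :: "'x topology \<Rightarrow> ('x \<Rightarrow> real) set \<Rightarrow> bool" where
  "C_subalgebra X A \<longleftrightarrow>
     A \<subseteq> mspace (C_space X) \<and> A \<noteq> {} \<and>
     (\<forall>f\<in>A. \<forall>g\<in>A. C_plus X f g \<in> A) \<and>
     (\<forall>c. \<forall>f\<in>A. C_scale X c f \<in> A) \<and>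
     (\<forall>f\<in>A. \<forall>g\<in>A. C_times X f g \<in> A)"

definition C_dense :: "'x topology \<Rightarrow> ('x \<Rightarrow> real) set \<Rightarrow> bool" where
  "C_dense X A \<longleftrightarrow> mtopology_of (C_space X) closure_of A = mspace (C_space X)"

definition ordered_algebra_iso ::
    "'a::real_algebra set \<Rightarrow> 'x topology \<Rightarrow> ('x \<Rightarrow> real) set \<Rightarrow> ('a \<Rightarrow> 'x \<Rightarrow> real) \<Rightarrow> bool" where
  "ordered_algebra_iso K X A \<phi> \<longleftrightarrow>
     bij_betw \<phi> UNIV A \<and>
     (\<forall>a b. \<phi> (a + b) = C_plus X (\<phi> a) (\<phi> b)) \<and>
     (\<forall>c a. \<phi> (c *\<^sub>R a) = C_scale X c (\<phi> a)) \<and>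
     (\<forall>a b. \<phi> (a * b) = C_times X (\<phi> a) (\<phi> b)) \<and>
     (\<forall>a. a \<in> K \<longleftrightarrow> \<phi> a \<in> C_nonneg X)"

text \<open>
  HOL cannot quantify over the type of points of \<open>X\<close>. Points are taken to be real-valued functions
  on the algebra, which loses no generality: since the image of \<open>\<phi>\<close> is dense it separates points
  of \<open>X\<close>, so \<open>x \<mapsto> (\<lambda>a. \<phi> a x)\<close> embeds any such compact Hausdorff \<open>X\<close>. The space may be
  empty, which happens precisely for the zero algebra.
\<close>
definition phase_algebra :: "'a::real_algebra set \<Rightarrow> bool" where
  "phase_algebra K \<longleftrightarrow>
     (\<exists>(X :: ('a \<Rightarrow> real) topology) A \<phi>.
        compact_space X \<and> Hausdorff_space X \<and>
        C_subalgebra X A \<and> C_dense X A \<and> ordered_algebra_iso K X A \<phi>)"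

end

theory Submission
  imports Defs
begin

text \<open>
  The points of the compact space are the positive unital characters of the algebra, with the
  topology of pointwise convergence, and density of the image is the Stone-Weierstrass theorem.
  The point is that for \<open>a \<notin> K\<close> some character is negative at \<open>a\<close>. By closedness on lines also
  \<open>b = a + \<epsilon> e \<notin> K\<close> for some \<open>\<epsilon> > 0\<close>. Then \<open>K - K b\<close> is a \<open>K\<close>-module omitting \<open>-e\<close>: otherwise
  \<open>h b \<in> e + K\<close> with \<open>h \<in> K\<close>, which forces \<open>b \<in> K\<close>. A maximal \<open>K\<close>-module \<open>M\<close> above it satisfies
  \<open>M \<union> -M =\<close> everything, so \<open>b \<mapsto> sup {t. b - t e \<in> M}\<close> is linear, and it is multiplicative
  because its kernel is stable under \<open>K\<close> and \<open>K\<close> spans the algebra.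
\<close>

section \<open>Separation axioms for the topology of pointwise convergence\<close>

lemma open_coordinate_vimage:
  fixes W :: "'b::topological_space set"
  assumes "open W"
  shows "open ((\<lambda>h::'a \<Rightarrow> 'b. h i) -` W)"
  by (rule open_vimage[OF assms continuous_on_product_coordinates])

\<comment> \<open>The weaker separation classes must come first: metric function spaces over a countable index
  type already have instances of them, and the arities have to stay coherent.\<close>
instance "fun" :: (type, t0_space) t0_space
proof
  fix f g :: "'a \<Rightarrow> 'b"
  assume "f \<noteq> g"
  then obtain i where "f i \<noteq> g i" by blast
  from iffD1[OF separation_t0 this] obtain U where "open U \<and> \<not> (f i \<in> U \<longleftrightarrow> g i \<in> U)" ..
  then show "\<exists>U. open U \<and> \<not> (f \<in> U \<longleftrightarrow> g \<in> U)"
    by (intro exI[of _ "(\<lambda>h. h i) -` U"]) (simp add: open_coordinate_vimage)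
qed

instance "fun" :: (type, t1_space) t1_space
proof
  fix f g :: "'a \<Rightarrow> 'b"
  assume "f \<noteq> g"
  then obtain i where "f i \<noteq> g i" by blast
  from iffD1[OF separation_t1 this] obtain U where "open U" "f i \<in> U" "g i \<notin> U"
    by blast
  then show "\<exists>U. open U \<and> f \<in> U \<and> g \<notin> U"
    by (intro exI[of _ "(\<lambda>h. h i) -` U"]) (auto intro: open_coordinate_vimage)
qed

text \<open>Stone-Weierstrass is applied below to functions on a set of characters, and it asks for
  a Hausdorff type of points.\<close>

instance "fun" :: (type, t2_space) t2_space
proof
  fix f g :: "'a \<Rightarrow> 'b"
  assume "f \<noteq> g"
  then obtain i where "f i \<noteq> g i" by blast
  then obtain U V where "open U" "open V" "f i \<in> U" "g i \<in> V" "U \<inter> V = {}"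
    by (meson hausdorff)
  then show "\<exists>U V. open U \<and> open V \<and> f \<in> U \<and> g \<in> V \<and> U \<inter> V = {}"
    by (intro exI[of _ "(\<lambda>h. h i) -` U"] exI[of _ "(\<lambda>h. h i) -` V"])
      (auto intro: open_coordinate_vimage)
qed

section \<open>Modules over the cone, and positive characters\<close>

locale archimedean_semiordered_algebra =
  fixes K :: "'a::{real_algebra, comm_ring} set" and e :: 'a
  assumes K_add: "x \<in> K \<Longrightarrow> y \<in> K \<Longrightarrow> x + y \<in> K"
    and K_scale: "x \<in> K \<Longrightarrow> 0 \<le> c \<Longrightarrow> c *\<^sub>R x \<in> K"
    and K_mult: "x \<in> K \<Longrightarrow> y \<in> K \<Longrightarrow> x * y \<in> K"
    and K_pointed: "x \<in> K \<Longrightarrow> - x \<in> K \<Longrightarrow> x = 0"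
    and unit [simp]: "e * x = x"
    and unit_in_K: "e \<in> K"
    and bounded: "\<exists>t>0. t *\<^sub>R e - x \<in> K \<and> t *\<^sub>R e + x \<in> K"
    and K_closed: "d \<noteq> 0 \<Longrightarrow> closed {t::real. p + t *\<^sub>R d \<in> K}"
begin

lemma unit_right [simp]: "x * e = x"
  by (metis unit mult.commute)

lemma zero_in_K: "0 \<in> K"
  using K_scale[OF unit_in_K, of 0] by simp

text \<open>Omitting \<open>- e\<close> is properness: if \<open>- e\<close> were in
  \<open>M\<close>, each \<open>x = (t e + x) + t (- e)\<close> with \<open>t e + x \<in> K\<close>
  would be too.\<close>

definition proper_module :: "'a set \<Rightarrow> bool" where
  "proper_module M \<longleftrightarrow> K \<subseteq> M \<and> (\<forall>x\<in>M. \<forall>y\<in>M. x + y \<in> M) \<and> (\<forall>k\<in>K. \<forall>x\<in>M. k * x \<in> M) \<and> - e \<notin> M"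

definition characters :: "('a \<Rightarrow> real) set" where
  "characters = {\<phi>. (\<forall>a b. \<phi> (a + b) = \<phi> a + \<phi> b) \<and> (\<forall>c a. \<phi> (c *\<^sub>R a) = c * \<phi> a) \<and>
     (\<forall>a b. \<phi> (a * b) = \<phi> a * \<phi> b) \<and> \<phi> e = 1 \<and> (\<forall>a\<in>K. 0 \<le> \<phi> a)}"

lemma character_add: "\<phi> \<in> characters \<Longrightarrow> \<phi> (a + b) = \<phi> a + \<phi> b"
  and character_scale: "\<phi> \<in> characters \<Longrightarrow> \<phi> (c *\<^sub>R a) = c * \<phi> a"
  and character_mult: "\<phi> \<in> characters \<Longrightarrow> \<phi> (a * b) = \<phi> a * \<phi> b"
  and character_unit: "\<phi> \<in> characters \<Longrightarrow> \<phi> e = 1"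
  and character_nonneg: "\<phi> \<in> characters \<Longrightarrow> a \<in> K \<Longrightarrow> 0 \<le> \<phi> a"
  unfolding characters_def by blast+

lemma character_diff:
  assumes "\<phi> \<in> characters"
  shows "\<phi> (a - b) = \<phi> a - \<phi> b"
  using character_add[OF assms, of "a - b" b] by simp

lemma proper_module_add: "proper_module M \<Longrightarrow> x \<in> M \<Longrightarrow> y \<in> M \<Longrightarrow> x + y \<in> M"
  and proper_module_mult: "proper_module M \<Longrightarrow> k \<in> K \<Longrightarrow> x \<in> M \<Longrightarrow> k * x \<in> M"
  and proper_module_K: "proper_module M \<Longrightarrow> k \<in> K \<Longrightarrow> k \<in> M"
  and proper_module_proper: "proper_module M \<Longrightarrow> - e \<notin> M"
  by (auto simp: proper_module_def)

lemma proper_module_scale: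
  assumes "proper_module M" "x \<in> M" "0 \<le> c"
  shows "c *\<^sub>R x \<in> M"
  using proper_module_mult[OF assms(1) K_scale[OF unit_in_K assms(3)] assms(2)] by simp

section \<open>From maximal modules to characters\<close>

text \<open>If \<open>b\<close> and \<open>- b\<close> were both missing, adjoining either one would
  produce \<open>- e\<close>. The two resulting equations combine to \<open>- k \<in> M\<close>, and
  boundedness of \<open>b\<close> turns this into \<open>- e \<in> M\<close>.\<close>

lemma maximal_module_total:
  assumes M: "proper_module M" and max: "\<And>N. proper_module N \<Longrightarrow> M \<subseteq> N \<Longrightarrow> N = M"
  shows "b \<in> M \<or> - b \<in> M"
proof (rule ccontr)
  \<comment> \<open>\<open>M + K c\<close> is a strictly larger module, so maximality allows it to
    fail only by containing \<open>- e\<close>.\<close>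
  have ext: "\<exists>m\<in>M. \<exists>k\<in>K. - e = m + k * c" if "c \<notin> M" for c
  proof -
    define N where "N = {m + k * c | m k. m \<in> M \<and> k \<in> K}"
    have NI: "m + k * c \<in> N" if "m \<in> M" "k \<in> K" for m k
      using that by (auto simp: N_def)
    have MN: "M \<subseteq> N"
      using NI[OF _ zero_in_K] by auto
    have "c \<in> N"
      using NI[OF proper_module_K[OF M zero_in_K] unit_in_K] by simp
    with that have "N \<noteq> M" by auto
    then have "\<not> proper_module N"
      using max MN by blast
    moreover have "K \<subseteq> N"
      using MN M by (auto simp: proper_module_def)
    moreover have "x + y \<in> N" if xy: "x \<in> N" "y \<in> N" for x y
    proof -
      obtain m k m' k' where "m \<in> M" "k \<in> K" "x = m + k * c" "m' \<in> M" "k' \<in> K" "y = m' + k' * c"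
        using xy by (auto simp: N_def)
      then show ?thesis
        using NI[OF proper_module_add[OF M, of m m'] K_add[of k k']] by (simp add: algebra_simps)
    qed
    moreover have "j * x \<in> N" if j: "j \<in> K" and x: "x \<in> N" for j x
    proof -
      obtain m k where "m \<in> M" "k \<in> K" "x = m + k * c"
        using x by (auto simp: N_def)
      then show ?thesis
        using NI[OF proper_module_mult[OF M j, of m] K_mult[OF j, of k]] by (simp add: algebra_simps)
    qed
    ultimately have "- e \<in> N"
      unfolding proper_module_def by blast
    then show ?thesis
      by (auto simp: N_def)
  qed
  assume "\<not> (b \<in> M \<or> - b \<in> M)"
  then obtain m k n j where m: "m \<in> M" and k: "k \<in> K" and eq1: "- e = m + k * b"
    and n: "n \<in> M" and j: "j \<in> K" and eq2: "- e = n + j * (- b)"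
    using ext[of b] ext[of "- b"] by blast
  \<comment> \<open>Multiplying the two equations by \<open>j\<close> and \<open>k\<close> and adding eliminates \<open>b\<close>.\<close>
  have "- k = j * (- e) + k * (- e) + j"
    by simp
  also have "\<dots> = j * (m + k * b) + k * (n + j * (- b)) + j"
    using eq1 eq2 by simp
  also have "\<dots> = (j * m + k * n) + j"
    by (simp add: algebra_simps)
  also have "\<dots> \<in> M"
    by (intro proper_module_add[OF M] proper_module_mult[OF M] proper_module_K[OF M] m n j k)
  finally have mk: "- k \<in> M" .
  obtain t where t: "t > 0" "t *\<^sub>R e + b \<in> K"
    using bounded by blast
  have "k * b = - e - m"
    using eq1 by (simp add: algebra_simps)
  \<comment> \<open>Writing \<open>k b\<close> as \<open>k (t e + b) - t k\<close> shows that it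
    lies in \<open>M\<close>, although \<open>b\<close> does not.\<close>
  then have "- e = k * (t *\<^sub>R e + b) + t *\<^sub>R (- k) + m"
    by (simp add: algebra_simps)
  also have "\<dots> \<in> M"
    using t by (intro proper_module_add[OF M] proper_module_scale[OF M] proper_module_K[OF M] K_mult k mk m) auto
  finally show False
    using proper_module_proper[OF M] by simp
qed

text \<open>Totality makes each \<open>L b\<close> a half-line up to its endpoint
  \<open>\<phi> b\<close>. Nothing is known at the endpoint itself, so the algebraic laws are proved
  with small shifts that tend to zero.\<close>

lemma maximal_module_character:
  assumes M: "proper_module M" and max: "\<And>N. proper_module N \<Longrightarrow> M \<subseteq> N \<Longrightarrow> N = M"
  shows "\<exists>\<phi>\<in>characters. \<forall>m\<in>M. 0 \<le> \<phi> m"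
proof -
  define L where "L b = {t. b - t *\<^sub>R e \<in> M}" for b
  define \<phi> where "\<phi> b = Sup (L b)" for b
  have scalar: "0 \<le> c" if "c *\<^sub>R e \<in> M" for c
  proof (rule ccontr)
    assume "\<not> 0 \<le> c"
    then have "(- (1 / c)) *\<^sub>R c *\<^sub>R e \<in> M"
      using that by (intro proper_module_scale[OF M that]) auto
    with \<open>\<not> 0 \<le> c\<close> show False
      using proper_module_proper[OF M] by simp
  qed
  \<comment> \<open>Adding the two memberships cancels \<open>b\<close> and leaves a multiple of
    \<open>e\<close>, whose coefficient cannot be negative.\<close>
  have gap: "s \<le> t" if "b - s *\<^sub>R e \<in> M" "t *\<^sub>R e - b \<in> M" for b s t
  proof -
    have "(t - s) *\<^sub>R e \<in> M"
      using proper_module_add[OF M that] by (simp add: algebra_simps)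
    then show ?thesis
      using scalar by fastforce
  qed
  have ex: "\<exists>t. t \<in> L b" "\<exists>t. t *\<^sub>R e - b \<in> M" for b
  proof -
    obtain t where "t *\<^sub>R e - b \<in> K" "t *\<^sub>R e + b \<in> K"
      using bounded by blast
    then have "b - (- t) *\<^sub>R e \<in> M" "t *\<^sub>R e - b \<in> M"
      using proper_module_K[OF M] by (simp_all add: add.commute)
    then show "\<exists>t. t \<in> L b" "\<exists>t. t *\<^sub>R e - b \<in> M"
      unfolding L_def by blast+
  qed
  have bdd: "bdd_above (L b)" for b
    using ex(2)[of b] gap[of b] by (auto simp: L_def bdd_above_def)
  have lower: "s \<le> \<phi> b" if "b - s *\<^sub>R e \<in> M" for b s
    unfolding \<phi>_def by (rule cSup_upper[OF _ bdd]) (use that in \<open>simp add: L_def\<close>)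
  have upper: "\<phi> b \<le> t" if "t *\<^sub>R e - b \<in> M" for b t
    unfolding \<phi>_def by (rule cSup_least) (use ex(1) gap that in \<open>auto simp: L_def\<close>)
  have above: "t *\<^sub>R e - b \<in> M" if "\<phi> b < t" for b t
    using maximal_module_total[OF M max, of "b - t *\<^sub>R e"] lower[of b t] that by auto
  have below: "b - s *\<^sub>R e \<in> M" if "s < \<phi> b" for b s
    using maximal_module_total[OF M max, of "b - s *\<^sub>R e"] upper[of s b] that by auto
  have nonneg: "0 \<le> \<phi> m" if "m \<in> M" for m
    using lower[of m 0] that by simp
  have add: "\<phi> (a + b) = \<phi> a + \<phi> b" for a b
  proof (rule antisym; rule field_le_epsilon)
    fix r :: real assume r: "0 < r"
    have "(\<phi> a + r/2) *\<^sub>R e - a + ((\<phi> b + r/2) *\<^sub>R e - b) \<in> M"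
      using r by (intro proper_module_add[OF M] above) auto
    moreover have "(\<phi> a + r/2) *\<^sub>R e - a + ((\<phi> b + r/2) *\<^sub>R e - b)
        = ((\<phi> a + r/2) + (\<phi> b + r/2)) *\<^sub>R e - (a + b)"
      by (simp only: scaleR_left_distrib) simp
    ultimately have "\<phi> (a + b) \<le> (\<phi> a + r/2) + (\<phi> b + r/2)"
      using upper by metis
    then show "\<phi> (a + b) \<le> \<phi> a + \<phi> b + r"
      by simp
    have "a - (\<phi> a - r/2) *\<^sub>R e + (b - (\<phi> b - r/2) *\<^sub>R e) \<in> M"
      using r by (intro proper_module_add[OF M] below) auto
    moreover have "a - (\<phi> a - r/2) *\<^sub>R e + (b - (\<phi> b - r/2) *\<^sub>R e)
        = (a + b) - ((\<phi> a - r/2) + (\<phi> b - r/2)) *\<^sub>R e"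
      by (simp only: scaleR_left_distrib) simp
    ultimately have "(\<phi> a - r/2) + (\<phi> b - r/2) \<le> \<phi> (a + b)"
      using lower by metis
    then show "\<phi> a + \<phi> b \<le> \<phi> (a + b) + r"
      by simp
  qed
  have scalar_eq: "\<phi> (c *\<^sub>R e) = c" for c
    using lower[of "c *\<^sub>R e" c] upper[of c "c *\<^sub>R e"] proper_module_K[OF M zero_in_K] by auto
  have unit1: "\<phi> e = 1"
    using scalar_eq[of 1] by simp
  have zero: "\<phi> 0 = 0"
    using scalar_eq[of 0] by simp
  have minus: "\<phi> (- a) = - \<phi> a" for a
    using add[of a "- a"] zero by simp
  \<comment> \<open>The element \<open>a\<close> may lie outside \<open>M\<close>, but
    \<open>a + u e\<close> is in \<open>M\<close> for every \<open>u > 0\<close>. With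
    \<open>u (\<phi> k + 1) = r\<close> the error is at most \<open>r\<close>; the summand 1 keeps
    the denominator positive and gives the strict inequality that \<open>above\<close>
    requires.\<close>
  have K_mono: "0 \<le> \<phi> (k * a)" if k: "k \<in> K" and a: "0 \<le> \<phi> a" for k a
  proof (rule field_le_epsilon)
    fix r :: real assume r: "0 < r"
    define u where "u = r / (\<phi> k + 1)"
    have k0: "0 \<le> \<phi> k"
      using nonneg proper_module_K[OF M k] by simp
    then have u: "0 < u" "u * (\<phi> k + 1) = r"
      using r by (auto simp: u_def)
    have "a - (- u) *\<^sub>R e \<in> M"
      using a u by (intro below) auto
    then have "0 \<le> \<phi> (k * (a - (- u) *\<^sub>R e))"
      by (intro nonneg proper_module_mult[OF M k])
    also have "k * (a - (- u) *\<^sub>R e) = k * a + (u *\<^sub>R e) * k"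
      by (simp add: algebra_simps)
    finally have *: "0 \<le> \<phi> (k * a) + \<phi> (u *\<^sub>R k)"
      using add by simp
    have "\<phi> (u *\<^sub>R k) \<le> u * \<phi> k + u"
    proof (rule upper)
      have "u *\<^sub>R ((\<phi> k + 1) *\<^sub>R e - k) \<in> M"
        using u by (intro proper_module_scale[OF M] above) auto
      then show "(u * \<phi> k + u) *\<^sub>R e - u *\<^sub>R k \<in> M"
        by (simp add: algebra_simps)
    qed
    also have "\<dots> = r"
      using u by (simp add: distrib_left)
    finally show "0 \<le> \<phi> (k * a) + r"
      using * by simp
  qed
  have kernel_K: "\<phi> (k * a) = 0" if "k \<in> K" "\<phi> a = 0" for k a
    using K_mono[of k a] K_mono[of k "- a"] that by (simp add: minus)
  \<comment> \<open>Every \<open>b\<close> is the difference of \<open>t e + b\<close> and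
    \<open>t e\<close>, both in \<open>K\<close> for suitable \<open>t\<close>, so the kernel is an
    ideal.\<close>
  have kernel: "\<phi> (b * a) = 0" if a: "\<phi> a = 0" for a b
  proof -
    obtain t where t: "t > 0" "t *\<^sub>R e + b \<in> K"
      using bounded by blast
    have "\<phi> ((t *\<^sub>R e + b) * a) = \<phi> ((t *\<^sub>R e) * a) + \<phi> (b * a)"
      using add by (simp only: distrib_right)
    then show ?thesis
      using kernel_K[OF t(2) a] kernel_K[of "t *\<^sub>R e" a] K_scale[OF unit_in_K, of t] t(1) a
      by simp
  qed
  have scale_pos: "\<phi> (c *\<^sub>R a) = c * \<phi> a" if c: "0 < c" for c a
  proof (rule antisym)
    have "\<phi> (c *\<^sub>R a) \<le> c * \<phi> a + r" if r: "0 < r" for r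
    proof (rule upper)
      have "c *\<^sub>R ((\<phi> a + r/c) *\<^sub>R e - a) \<in> M"
        using c r by (intro proper_module_scale[OF M] above) auto
      also have "c *\<^sub>R ((\<phi> a + r/c) *\<^sub>R e - a) = (c * \<phi> a + r) *\<^sub>R e - c *\<^sub>R a"
        using c by (simp add: algebra_simps)
      finally show "(c * \<phi> a + r) *\<^sub>R e - c *\<^sub>R a \<in> M" .
    qed
    then show "\<phi> (c *\<^sub>R a) \<le> c * \<phi> a"
      by (rule field_le_epsilon)
    have "c * \<phi> a - r \<le> \<phi> (c *\<^sub>R a)" if r: "0 < r" for r
    proof (rule lower)
      have "c *\<^sub>R (a - (\<phi> a - r/c) *\<^sub>R e) \<in> M"
        using c r by (intro proper_module_scale[OF M] below) auto
      also have "c *\<^sub>R (a - (\<phi> a - r/c) *\<^sub>R e) = c *\<^sub>R a - (c * \<phi> a - r) *\<^sub>R e"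
        using c by (simp add: algebra_simps)
      finally show "c *\<^sub>R a - (c * \<phi> a - r) *\<^sub>R e \<in> M" .
    qed
    then show "c * \<phi> a \<le> \<phi> (c *\<^sub>R a)"
      by (simp add: field_le_epsilon diff_le_eq)
  qed
  have scale: "\<phi> (c *\<^sub>R a) = c * \<phi> a" for c a
    using scale_pos[of c a] scale_pos[of "- c" a] zero by (cases c "0::real" rule: linorder_cases) (auto simp: minus)
  have mult: "\<phi> (b * a) = \<phi> b * \<phi> a" for a b
  proof -
    \<comment> \<open>Subtracting its value times \<open>e\<close> moves \<open>a\<close> into the
      kernel.\<close>
    have "\<phi> (a + (- \<phi> a) *\<^sub>R e) = 0"
      by (simp only: add scale unit1)
    then have "\<phi> (b * (a + (- \<phi> a) *\<^sub>R e)) = 0"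
      by (rule kernel)
    then have "\<phi> (b * a + (- \<phi> a) *\<^sub>R b) = 0"
      by (simp add: algebra_simps)
    then show ?thesis
      by (simp only: add scale) simp
  qed
  have "\<phi> \<in> characters"
    unfolding characters_def using add scale mult unit1 nonneg proper_module_K[OF M] by blast
  then show ?thesis
    using nonneg by blast
qed

text \<open>The union of a nonempty chain of proper modules still omits \<open>- e\<close>, so
  Zorn's lemma gives a maximal one above \<open>M\<close>.\<close>

lemma proper_module_extends_to_character:
  assumes M: "proper_module M"
  shows "\<exists>\<phi>\<in>characters. \<forall>m\<in>M. 0 \<le> \<phi> m"
proof -
  let ?A = "{N. proper_module N \<and> M \<subseteq> N}"
  have "\<exists>N\<in>?A. \<forall>X\<in>?A. N \<subseteq> X \<longrightarrow> X = N"
  proof (rule subset_Zorn_nonempty)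
    show "?A \<noteq> {}"
      using M by auto
    fix C assume ne: "C \<noteq> {}" and ch: "subset.chain ?A C"
    then have C: "proper_module N" "M \<subseteq> N" if "N \<in> C" for N
      using that by (auto simp: subset_chain_def)
    have "x + y \<in> \<Union>C" if xy: "x \<in> \<Union>C" "y \<in> \<Union>C" for x y
    proof -
      obtain N N' where N: "N \<in> C" "x \<in> N" "N' \<in> C" "y \<in> N'"
        using xy by blast
      then have "N \<subseteq> N' \<or> N' \<subseteq> N"
        using ch unfolding subset_chain_def by blast
      then show ?thesis
        using N proper_module_add[OF C(1)] by blast
    qed
    moreover have "k * x \<in> \<Union>C" if "k \<in> K" "x \<in> \<Union>C" for k x
      using that proper_module_mult[OF C(1)] by blast
    moreover have "K \<subseteq> \<Union>C" "M \<subseteq> \<Union>C"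
      using ne C proper_module_K by blast+
    moreover have "- e \<notin> \<Union>C"
      using C(1) proper_module_proper by blast
    ultimately show "\<Union>C \<in> ?A"
      unfolding proper_module_def by blast
  qed
  then obtain N where "N \<in> ?A" and max: "\<forall>X\<in>?A. N \<subseteq> X \<longrightarrow> X = N" ..
  then have N: "proper_module N" "M \<subseteq> N"
    by simp_all
  have "X = N" if "proper_module X" "N \<subseteq> X" for X
    using max that N(2) by simp
  then obtain \<phi> where "\<phi> \<in> characters" "\<forall>m\<in>N. 0 \<le> \<phi> m"
    using maximal_module_character[OF N(1)] by blast
  then show ?thesis
    using N(2) by blast
qed

section \<open>Separating an element from the cone\<close>

text \<open>Boundedness puts some \<open>b + t e\<close> in \<open>K\<close>. The shift can be
  lowered by a fixed amount while it is nonnegative, so finitely many steps make it nonpositive, and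
  then \<open>b\<close> itself is in \<open>K\<close>.\<close>

lemma dividing_positive_unit_imp_positive:
  assumes h: "h \<in> K" and k: "k \<in> K" and eq: "h * b = e + k"
  shows "b \<in> K"
proof -
  obtain s where s: "s > 0" "s *\<^sub>R e - h \<in> K"
    using bounded by blast
  obtain t where t: "t > 0" "t *\<^sub>R e + b \<in> K"
    using bounded by blast
  have neg: "b \<in> K" if "b + u *\<^sub>R e \<in> K" "u \<le> 0" for u
    using K_add[OF that(1) K_scale[OF unit_in_K, of "- u"]] that(2) by simp
  \<comment> \<open>Multiplying \<open>b + u e\<close> by \<open>s e - h\<close> lowers the shift \<open>u\<close> by the fixed amount \<open>1 / s\<close>.\<close>
  have step: "b + (u - 1/s) *\<^sub>R e \<in> K" if u: "0 \<le> u" "b + u *\<^sub>R e \<in> K" for u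
  proof -
    \<comment> \<open>By \<open>eq\<close>, the product contains \<open>- h b = - e - k\<close>; the
      added terms cancel \<open>- k\<close> and \<open>- u h\<close>, leaving the gain
      \<open>- e\<close>.\<close>
    have "(s *\<^sub>R e - h) * (b + u *\<^sub>R e) + k + u *\<^sub>R h \<in> K"
      by (intro K_add K_mult K_scale s h k u)
    also have "(s *\<^sub>R e - h) * (b + u *\<^sub>R e) + k + u *\<^sub>R h = s *\<^sub>R b + (s * u) *\<^sub>R e - e"
      using eq by (simp add: algebra_simps)
    finally have "(1/s) *\<^sub>R (s *\<^sub>R b + (s * u) *\<^sub>R e - e) \<in> K"
      using s by (intro K_scale) auto
    then show ?thesis
      using s by (simp add: algebra_simps)
  qed
  \<comment> \<open>\<open>step\<close> needs a nonnegative shift; once the shift is negative, the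
    first alternative takes over.\<close>
  have "b \<in> K \<or> b + (t - real n / s) *\<^sub>R e \<in> K" for n
  proof (induction n)
    case 0
    then show ?case using t by (simp add: add.commute)
  next
    case (Suc n)
    show ?case
    proof (cases "0 \<le> t - real n / s \<and> b \<notin> K")
      case True
      then have "b + (t - real n / s - 1/s) *\<^sub>R e \<in> K"
        using Suc step by blast
      then show ?thesis
        by (simp add: add_divide_distrib algebra_simps)
    next
      case False
      then show ?thesis
        using Suc neg[of "t - real n / s"] by auto
    qed
  qed
  moreover obtain n where "t * s \<le> real n"
    using real_arch_simple by blast
  then have "t - real n / s \<le> 0"
    using s by (simp add: field_simps)
  ultimately show ?thesis
    using neg by blast
qed

lemma separating_character:
  assumes "a \<notin> K"
  shows "\<exists>\<phi>\<in>characters. \<phi> a < 0"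
proof -
  \<comment> \<open>Closedness is available only along nonzero directions; with \<open>e = 0\<close>
    one would get \<open>a = e a = 0 \<in> K\<close>.\<close>
  have "e \<noteq> 0"
    using assms zero_in_K unit[of a] by (metis mult_zero_left)
  then have "open (- {t::real. a + t *\<^sub>R e \<in> K})"
    using K_closed by (simp add: open_Compl)
  moreover have "0 \<in> - {t::real. a + t *\<^sub>R e \<in> K}"
    using assms by simp
  ultimately obtain r where r: "r > 0" "ball 0 r \<subseteq> - {t::real. a + t *\<^sub>R e \<in> K}"
    using openE by blast
  \<comment> \<open>A character nonnegative on \<open>- b\<close> satisfies only
    \<open>\<phi> b \<le> 0\<close>; the shift by \<open>r/2\<close> makes the value at
    \<open>a\<close> strictly negative.\<close>
  define b where "b = a + (r/2) *\<^sub>R e"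
  have "r/2 \<in> ball 0 r"
    using r by simp
  with r(2) have b: "b \<notin> K"
    unfolding b_def by blast
  define M where "M = {k - h * b | k h. k \<in> K \<and> h \<in> K}"
  have MI: "k - h * b \<in> M" if "k \<in> K" "h \<in> K" for k h
    using that by (auto simp: M_def)
  have "K \<subseteq> M"
    using MI[OF _ zero_in_K] by auto
  moreover have "x + y \<in> M" if xy: "x \<in> M" "y \<in> M" for x y
  proof -
    obtain k h k' h' where "k \<in> K" "h \<in> K" "x = k - h * b" "k' \<in> K" "h' \<in> K" "y = k' - h' * b"
      using xy by (auto simp: M_def)
    moreover from this have "(k - h * b) + (k' - h' * b) \<in> M"
      using MI[OF K_add[of k k'] K_add[of h h']] by (simp add: algebra_simps)
    ultimately show ?thesis
      by simp
  qed
  moreover have "j * x \<in> M" if j: "j \<in> K" and x: "x \<in> M" for j x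
  proof -
    obtain k h where "k \<in> K" "h \<in> K" "x = k - h * b"
      using x by (auto simp: M_def)
    moreover from this have "j * (k - h * b) \<in> M"
      using MI[OF K_mult[OF j, of k] K_mult[OF j, of h]] by (simp add: algebra_simps)
    ultimately show ?thesis
      by simp
  qed
  moreover have "- e \<notin> M"
  proof
    assume "- e \<in> M"
    then obtain k h where "k \<in> K" "h \<in> K" "- e = k - h * b"
      by (auto simp: M_def)
    then show False
      using dividing_positive_unit_imp_positive[of h k b] b by (simp add: algebra_simps)
  qed
  ultimately have "proper_module M"
    by (auto simp: proper_module_def)
  then obtain \<phi> where \<phi>: "\<phi> \<in> characters" "\<forall>m\<in>M. 0 \<le> \<phi> m"
    using proper_module_extends_to_character by blast
  have "- b \<in> M"
    using MI[OF zero_in_K unit_in_K] by simp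
  then have "0 \<le> \<phi> ((-1) *\<^sub>R b)"
    using \<phi> by simp
  moreover have "\<phi> ((-1) *\<^sub>R b) = -1 * \<phi> b"
    by (rule character_scale[OF \<phi>(1)])
  moreover have "\<phi> b = \<phi> a + r/2"
    unfolding b_def by (simp add: character_add[OF \<phi>(1)] character_scale[OF \<phi>(1)] character_unit[OF \<phi>(1)])
  ultimately have "\<phi> a < 0"
    using r(1) by simp
  then show ?thesis
    using \<phi>(1) by blast
qed

lemma in_K_iff: "a \<in> K \<longleftrightarrow> (\<forall>\<phi>\<in>characters. 0 \<le> \<phi> a)"
  using separating_character[of a] character_nonneg by (meson not_le)

section \<open>Compactness of the character space\<close>

text \<open>As in Banach-Alaoglu, boundedness confines each value \<open>\<phi> a\<close> to a fixed
  interval. The characters thus form a closed subset of a product of compact intervals, which is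
  compact by Tychonoff.\<close>

lemma compact_characters: "compact characters"
proof -
  obtain t where t: "\<And>a. t a *\<^sub>R e - a \<in> K" "\<And>a. t a *\<^sub>R e + a \<in> K"
    using bounded by metis
  have "compactin (product_topology (\<lambda>_. euclideanreal) UNIV) (PiE UNIV (\<lambda>a. {- t a..t a}))"
    by (simp add: compactin_PiE)
  then have "compact (PiE UNIV (\<lambda>a. {- t a..t a}))"
    by (simp add: euclidean_product_topology)
  \<comment> \<open>Each defining condition is an equation or weak inequality between finitely many
    coordinates.\<close>
  moreover have "closed characters"
    unfolding characters_def Ball_def
    by (intro closed_Collect_conj closed_Collect_all closed_Collect_imp closed_Collect_eq
        closed_Collect_le continuous_intros continuous_on_product_coordinates) simp
  moreover have "\<phi> \<in> PiE UNIV (\<lambda>a. {- t a..t a})" if \<phi>: "\<phi> \<in> characters" for \<phi>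
  proof -
    have "t a *\<^sub>R e + c *\<^sub>R a \<in> K" if "c = 1 \<or> c = -1" for a c
      using t[of a] that by auto
    then have "0 \<le> \<phi> (t a *\<^sub>R e + c *\<^sub>R a)" if "c = 1 \<or> c = -1" for a c
      using character_nonneg[OF \<phi>] that by blast
    then have "0 \<le> t a + c * \<phi> a" if "c = 1 \<or> c = -1" for a c
      using that by (simp add: character_add[OF \<phi>] character_scale[OF \<phi>] character_unit[OF \<phi>])
    from this[of 1] this[of "-1"] have "0 \<le> t a + \<phi> a" "\<phi> a \<le> t a" for a
      by simp_all
    then have "\<phi> a \<in> {- t a..t a}" for a
      by (smt (verit) atLeastAtMost_iff)
    then show ?thesis
      by (simp add: PiE_iff)
  qed
  ultimately show ?thesis
    by (metis (no_types, lifting) compact_Int_closed inf.absorb_iff2 subsetI)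
qed

section \<open>The Gelfand transform as an order isomorphism onto its image\<close>

definition char_space :: "('a \<Rightarrow> real) topology" where
  "char_space = top_of_set characters"

text \<open>The restriction matches the extensional functions that make up
  \<open>C_space\<close>.\<close>

definition gelfand :: "'a \<Rightarrow> ('a \<Rightarrow> real) \<Rightarrow> real" where
  "gelfand a = (\<lambda>\<phi>\<in>characters. \<phi> a)"

lemma topspace_char_space [simp]: "topspace char_space = characters"
  by (simp add: char_space_def)

lemma compact_char_space: "compact_space char_space"
  using compact_characters by (simp add: char_space_def compact_space_subtopology)

lemma Hausdorff_char_space: "Hausdorff_space char_space"
  unfolding char_space_def
  by (metis Hausdorff_space_euclidean Hausdorff_space_product_topology Hausdorff_space_subtopology
      euclidean_product_topology)

lemma mspace_C_char_space:
  "mspace (C_space char_space) = {f \<in> extensional characters. continuous_on characters f}"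
proof -
  have "bounded (f ` characters)" if "continuous_on characters f" for f :: "_ \<Rightarrow> real"
    using that compact_characters by (simp add: compact_continuous_image compact_imp_bounded)
  then show ?thesis
    by (auto simp: char_space_def)
qed

lemma gelfand_in_C: "gelfand a \<in> mspace (C_space char_space)"
proof -
  have "continuous_on characters (gelfand a)"
    by (subst continuous_on_cong[OF refl, of _ _ "\<lambda>\<phi>. \<phi> a"])
      (auto simp: gelfand_def intro: continuous_on_subset[OF continuous_on_product_coordinates])
  then show ?thesis
    by (simp add: mspace_C_char_space gelfand_def del: mspace_cfunspace)
qed

lemma gelfand_plus: "gelfand (a + b) = C_plus char_space (gelfand a) (gelfand b)"
  and gelfand_scale: "gelfand (c *\<^sub>R a) = C_scale char_space c (gelfand a)"
  and gelfand_times: "gelfand (a * b) = C_times char_space (gelfand a) (gelfand b)"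
  unfolding gelfand_def C_plus_def C_scale_def C_times_def topspace_char_space
  by (rule restrict_ext, simp add: character_add character_scale character_mult)+

lemma gelfand_nonneg_iff: "gelfand a \<in> C_nonneg char_space \<longleftrightarrow> a \<in> K"
proof -
  have "gelfand a \<in> C_nonneg char_space \<longleftrightarrow> (\<forall>\<phi>\<in>characters. 0 \<le> gelfand a \<phi>)"
    using gelfand_in_C[of a] unfolding C_nonneg_def topspace_char_space by blast
  also have "\<dots> \<longleftrightarrow> a \<in> K"
    by (simp add: in_K_iff gelfand_def)
  finally show ?thesis .
qed

text \<open>Equal transforms put both \<open>a - b\<close> and \<open>b - a\<close> in
  \<open>K\<close>, and \<open>K\<close> is pointed.\<close>

lemma inj_gelfand: "inj gelfand"
proof (rule injI)
  fix a b assume eq: "gelfand a = gelfand b"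
  have same: "\<phi> a = \<phi> b" if "\<phi> \<in> characters" for \<phi>
    using fun_cong[OF eq, of \<phi>] that by (simp add: gelfand_def)
  have "0 \<le> \<phi> (a - b)" "0 \<le> \<phi> (b - a)" if "\<phi> \<in> characters" for \<phi>
    by (simp_all add: character_diff[OF that] same[OF that])
  then have "a - b \<in> K" "b - a \<in> K"
    by (auto simp: in_K_iff)
  then show "a = b"
    using K_pointed[of "a - b"] by simp
qed

section \<open>Density of the image\<close>

lemma dense_gelfand: "C_dense char_space (range gelfand)"
proof -
  \<comment> \<open>The library version of Stone-Weierstrass wants the constants on the whole type, so functions
    are only compared on the characters.\<close>
  define R where "R = {f. \<exists>a. \<forall>\<phi>\<in>characters. f \<phi> = \<phi> a}"
  interpret function_ring_on R characters
  proof
    show "compact characters"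
      by (rule compact_characters)
    show "continuous_on characters f" if f: "f \<in> R" for f
    proof -
      obtain a where "\<forall>\<phi>\<in>characters. f \<phi> = \<phi> a"
        using f by (auto simp: R_def)
      then show ?thesis
        by (subst continuous_on_cong[OF refl, of _ _ "\<lambda>\<phi>. \<phi> a"])
          (auto intro: continuous_on_subset[OF continuous_on_product_coordinates])
    qed
    show "(\<lambda>\<phi>. f \<phi> + g \<phi>) \<in> R" "(\<lambda>\<phi>. f \<phi> * g \<phi>) \<in> R" if fg: "f \<in> R" "g \<in> R" for f g
    proof -
      obtain a b where "\<forall>\<phi>\<in>characters. f \<phi> = \<phi> a" "\<forall>\<phi>\<in>characters. g \<phi> = \<phi> b"
        using fg by (auto simp: R_def)
      then have "\<forall>\<phi>\<in>characters. f \<phi> + g \<phi> = \<phi> (a + b)" "\<forall>\<phi>\<in>characters. f \<phi> * g \<phi> = \<phi> (a * b)"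
        by (simp_all add: character_add character_mult)
      then show "(\<lambda>\<phi>. f \<phi> + g \<phi>) \<in> R" "(\<lambda>\<phi>. f \<phi> * g \<phi>) \<in> R"
        unfolding R_def by blast+
    qed
    show "(\<lambda>_. c) \<in> R" for c
      unfolding R_def by (auto simp: character_scale character_unit intro!: exI[of _ "c *\<^sub>R e"])
    \<comment> \<open>Distinct characters differ as functions at some \<open>a\<close>, and
      evaluation at that \<open>a\<close> separates them.\<close>
    show "\<exists>f\<in>R. f \<phi> \<noteq> f \<psi>" if "\<phi> \<noteq> \<psi>" for \<phi> \<psi>
    proof -
      obtain a where "\<phi> a \<noteq> \<psi> a"
        using \<open>\<phi> \<noteq> \<psi>\<close> by blast
      then show ?thesis
        by (intro bexI[of _ "\<lambda>\<phi>. \<phi> a"]) (auto simp: R_def)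
    qed
  qed
  interpret C: Metric_space "mspace (C_space char_space)" "mdist (C_space char_space)"
    by (rule Metric_space_mspace_mdist)
  have "\<exists>g\<in>range gelfand. g \<in> C.mball f r" if f: "f \<in> mspace (C_space char_space)" and r: "0 < r" for f r
  proof -
    have "continuous_on characters f"
      using f by (simp add: mspace_C_char_space del: mspace_cfunspace)
    then obtain g where "g \<in> R" and g: "\<forall>\<phi>\<in>characters. \<bar>f \<phi> - g \<phi>\<bar> < r/2"
      using Stone_Weierstrass_basic[of f "r/2"] r by auto
    obtain a where a: "\<forall>\<phi>\<in>characters. g \<phi> = \<phi> a"
      using \<open>g \<in> R\<close> unfolding R_def by blast
    \<comment> \<open>Pointwise strict bounds give only a weak bound on the supremum;
      \<open>r/2\<close> leaves room for the open ball of radius \<open>r\<close>.\<close>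
    have "mdist (C_space char_space) f (gelfand a) \<le> r/2"
    proof (rule mdist_cfunspace_le)
      fix \<phi> assume "\<phi> \<in> topspace char_space"
      then have "\<phi> \<in> characters" "gelfand a \<phi> = g \<phi>"
        using a by (simp_all add: gelfand_def)
      then show "mdist euclidean_metric (f \<phi>) (gelfand a \<phi>) \<le> r/2"
        using g by (simp add: dist_real_def less_imp_le)
    qed (use r in simp)
    then show ?thesis
      using f r gelfand_in_C by (intro bexI[of _ "gelfand a"]) (auto simp: C.in_mball simp del: mspace_cfunspace)
  qed
  then show ?thesis
    unfolding C_dense_def mtopology_of_def by (auto simp: C.metric_closure_of simp del: mspace_cfunspace)
qed

lemma phase_algebra_K: "phase_algebra K"
  unfolding phase_algebra_def
proof (intro exI conjI)
  show "compact_space char_space" "Hausdorff_space char_space"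
    by (fact compact_char_space Hausdorff_char_space)+
  show "C_subalgebra char_space (range gelfand)"
    unfolding C_subalgebra_def
    using gelfand_in_C
    by (auto simp: gelfand_plus[symmetric] gelfand_scale[symmetric] gelfand_times[symmetric]
        simp del: mspace_cfunspace)
  show "C_dense char_space (range gelfand)"
    by (rule dense_gelfand)
  show "ordered_algebra_iso K char_space (range gelfand) gelfand"
    unfolding ordered_algebra_iso_def
    using inj_gelfand gelfand_plus gelfand_scale gelfand_times gelfand_nonneg_iff
    by (auto simp: bij_betw_def)
qed

end

section \<open>Passage from the stated hypotheses to the axioms of the locale\<close>

theorem theorem2p5:
  fixes K :: "'a::{real_algebra, comm_ring} set" and I :: 'a
  assumes "semiordered_algebra K"
    and "is_unit_elt I"
    and "I \<in> K"
    and "\<And>a. bounded_elt K I a"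
    and "closed_on_lines K"
  shows "phase_algebra K"
proof -
  interpret archimedean_semiordered_algebra K I
  proof
    have cc: "convex K \<and> cone K"
      using assms(1) by (simp add: semiordered_algebra_def ordering_cone_def)
    show "x + y \<in> K" if "x \<in> K" "y \<in> K" for x y
      using cc that unfolding convex_cone by blast
    show "c *\<^sub>R x \<in> K" if "x \<in> K" "0 \<le> c" for x c
      using cc that unfolding convex_cone by blast
    show "\<exists>t>0. t *\<^sub>R I - x \<in> K \<and> t *\<^sub>R I + x \<in> K" for x
      using assms(4)[of x] by (simp add: bounded_elt_def cone_le_def add.commute conj_commute)
    show "x * y \<in> K" if "x \<in> K" "y \<in> K" for x y
      using assms(1) that unfolding semiordered_algebra_def by blast
    show "x = 0" if "x \<in> K" "- x \<in> K" for x
      using assms(1) that unfolding semiordered_algebra_def ordering_cone_def by blast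
    show "I * x = x" for x
      using assms(2) unfolding is_unit_elt_def by blast
    show "I \<in> K"
      by (rule assms(3))
    show "closed {t::real. p + t *\<^sub>R d \<in> K}" if "d \<noteq> 0" for p d
      using assms(5) that unfolding closed_on_lines_def by blast
  qed
  show ?thesis
    by (rule phase_algebra_K)
qed

end
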